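(* Let $I=[-1,1]$ and let $\mathcal F=\{u_0,u_1,\dots,u_n\}$ be an $M$-system of real-valued continuous functions on $I$. Let $\sigma$ be a signed measure on $I$ with Jordan decomposition $\sigma=\sigma^+-\sigma^-$ such that $\mathrm{Supp}(\sigma^+)\subset E^+_{\mathfrak T_k}$ and $\mathrm{Supp}(\sigma^-)\subset E^-_{\mathfrak T_k}$ for some $1\le k\le n$, where $\mathfrak T_k$ is the $k$-th generalized Chebyshev polynomial of $\mathcal F$ on $I$. Then $\sigma$ is the unique solution to generalized minimal extrapolation given $\mathcal K_n(\sigma)$, i.e. $\sigma$ is the unique minimizer of $\|\mu\|_{TV}$ over all finite signed measures $\mu$ on $I$ with $\mathcal K_n(\mu)=\mathcal K_n(\sigma)$.
   Context: A set $\{u_0,\dots,u_k\}$ of continuous functions on $I$ is a $T$-system of degree $k$ if every $P=\sum_{l=0}^k a_l u_l$ with $(a_0,\dots,a_k)\ne(0,\dots,0)$ has at most $k$ zeros in $I$. The family $\{u_0,\dots,u_n\}$ is an $M$-system if $\{u_0,\dots,u_k\}$ is a $T$-system of degree $k$ for every $0\le k\le n$. For $1\le k\le n$, the generalized Chebyshev polynomial $\mathfrak T_k$ is the function (which is known to exist and to be unique) such that: $\mathfrak T_k\in\mathrm{Span}\{u_0,\dots,u_k\}$; there exist points $x_0<x_1<\dots<x_k$ in $I$ (alternation points) with $\mathfrak T_k(x_{i+1})=-\mathfrak T_k(x_i)=\pm\|\mathfrak T_k\|_\infty$ for $i=0,\dots,k-1$; and $\|\mathfrak T_k\|_\infty=1$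 with $\mathfrak T_k(\max I)>0$. Here $\|\cdot\|_\infty$ is the supremum norm on $I$. $E^+_{\mathfrak T_k}$ (resp. $E^-_{\mathfrak T_k}$) is the set of alternation points $x_i$ with $\mathfrak T_k(x_i)=\|\mathfrak T_k\|_\infty$ (resp. $\mathfrak T_k(x_i)=-\|\mathfrak T_k\|_\infty$). For a finite signed (Borel) measure $\mu$ on $I$, $\mathcal K_n(\mu)=\big(\int_I u_0\,d\mu,\dots,\int_I u_n\,d\mu\big)$, and $\|\mu\|_{TV}$ is the total variation norm. Generalized minimal extrapolation given $\mathcal K_n(\sigma)$ is the problem of minimizing $\|\mu\|_{TV}$ over all finite signed measures $\mu$ on $I$ with $\mathcal K_n(\mu)=\mathcal K_n(\sigma)$.
   Formalization: The alternation points of the Chebyshev polynomial need not be unique for a general M-system, and the claim fails for an arbitrary choice of them; the sets E^+ and E^- are therefore taken to contain only the points that occur in every alternation. *)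

theory Defs
  imports "HOL-Analysis.Analysis"
begin

abbreviation I :: "real set" where
  "I \<equiv> {-1..1}"

definition sup_norm :: "(real \<Rightarrow> real) \<Rightarrow> real" where
  "sup_norm f = (SUP x\<in>I. \<bar>f x\<bar>)"


subsection \<open>T-systems, M-systems and generalized Chebyshev polynomials\<close>

definition gen_poly :: "(nat \<Rightarrow> real \<Rightarrow> real) \<Rightarrow> nat \<Rightarrow> (nat \<Rightarrow> real) \<Rightarrow> real \<Rightarrow> real" where
  "gen_poly u k a = (\<lambda>x. \<Sum>l\<le>k. a l * u l x)"

definition T_system :: "(nat \<Rightarrow> real \<Rightarrow> real) \<Rightarrow> nat \<Rightarrow> bool" where
  "T_system u k \<longleftrightarrow>
     (\<forall>l\<le>k. continuous_on I (u l)) \<and>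
     (\<forall>a. (\<exists>l\<le>k. a l \<noteq> 0) \<longrightarrow>
        finite {x \<in> I. gen_poly u k a x = 0} \<and> card {x \<in> I. gen_poly u k a x = 0} \<le> k)"

definition M_system :: "(nat \<Rightarrow> real \<Rightarrow> real) \<Rightarrow> nat \<Rightarrow> bool" where
  "M_system u n \<longleftrightarrow> (\<forall>k\<le>n. T_system u k)"

definition alternation :: "(real \<Rightarrow> real) \<Rightarrow> nat \<Rightarrow> (nat \<Rightarrow> real) \<Rightarrow> bool" where
  "alternation T k x \<longleftrightarrow>
     (\<forall>i\<le>k. x i \<in> I) \<and> (\<forall>i<k. x i < x (Suc i)) \<and>
     (\<forall>i<k. T (x (Suc i)) = - T (x i) \<and> \<bar>T (x i)\<bar> = sup_norm T)"

definition gen_chebyshev :: "(nat \<Rightarrow> real \<Rightarrow> real) \<Rightarrow> nat \<Rightarrow> (real \<Rightarrow> real) \<Rightarrow> bool" where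
  "gen_chebyshev u k T \<longleftrightarrow>
     T \<in> range (gen_poly u k) \<and> (\<exists>x. alternation T k x) \<and> sup_norm T = 1 \<and> T 1 > 0"

text \<open>
  The sets \<open>E_plus\<close> and \<open>E_minus\<close> below are to depend on \<open>T\<close> only, but when the first function
  of the system is not constant \<open>T\<close> may admit several alternations (it may even be constantly 1
  on an interval). A point is therefore counted as an alternation point of \<open>T\<close> if it occurs in
  every alternation; when the alternation is unique these are just its points. Accepting
  the points of an arbitrary alternation would make the solution non-unique in general:
  for \<open>u 0 x = 2 - \<bar>x\<bar>\<close> and \<open>u 1 x = max (-1) (min 1 (2 * x))\<close> (an M-system on \<open>I\<close> whose Chebyshev
  polynomial for \<open>k = 1\<close> is \<open>u 1\<close>) the sequence \<open>-1, 3/4\<close> is an alternation, but the Dirac measure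
  at \<open>3/4\<close> and the mean of those at \<open>1/2\<close> and \<open>1\<close> have the same moments and the same norm.
\<close>

definition alternation_points :: "(real \<Rightarrow> real) \<Rightarrow> nat \<Rightarrow> real set" where
  "alternation_points T k = {t. \<forall>x. alternation T k x \<longrightarrow> t \<in> x ` {..k}}"

definition E_plus :: "(real \<Rightarrow> real) \<Rightarrow> nat \<Rightarrow> real set" where
  "E_plus T k = {t \<in> alternation_points T k. T t = sup_norm T}"

definition E_minus :: "(real \<Rightarrow> real) \<Rightarrow> nat \<Rightarrow> real set" where
  "E_minus T k = {t \<in> alternation_points T k. T t = - sup_norm T}"


subsection \<open>Finite signed measures on \<open>I\<close>\<close>

abbreviation borel_I :: "real measure" where
  "borel_I \<equiv> restrict_space borel I"

text \<open>
  A finite signed measure is a real-valued set function; its values outside \<open>sets borel_I\<close> are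
  irrelevant, so equality of signed measures means agreement on \<open>sets borel_I\<close>.
\<close>

definition signed_measure :: "(real set \<Rightarrow> real) \<Rightarrow> bool" where
  "signed_measure \<mu> \<longleftrightarrow>
     \<mu> {} = 0 \<and>
     (\<forall>A :: nat \<Rightarrow> real set. range A \<subseteq> sets borel_I \<longrightarrow> disjoint_family A \<longrightarrow>
        (\<lambda>i. \<mu> (A i)) sums \<mu> (\<Union>i. A i))"

definition signed_eq :: "(real set \<Rightarrow> real) \<Rightarrow> (real set \<Rightarrow> real) \<Rightarrow> bool" where
  "signed_eq \<mu> \<nu> \<longleftrightarrow> (\<forall>A\<in>sets borel_I. \<mu> A = \<nu> A)"

definition jordan_decomposition ::
    "(real set \<Rightarrow> real) \<Rightarrow> real measure \<Rightarrow> real measure \<Rightarrow> bool" where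
  "jordan_decomposition \<mu> P N \<longleftrightarrow>
     sets P = sets borel_I \<and> sets N = sets borel_I \<and> finite_measure P \<and> finite_measure N \<and>
     (\<exists>H\<in>sets borel_I. emeasure N H = 0 \<and> emeasure P (I - H) = 0) \<and>
     (\<forall>A\<in>sets borel_I. \<mu> A = measure P A - measure N A)"

text \<open>The Jordan decomposition theorem makes both descriptions proper for every signed measure.\<close>

definition pos_part :: "(real set \<Rightarrow> real) \<Rightarrow> real measure" where
  "pos_part \<mu> = (THE P. \<exists>N. jordan_decomposition \<mu> P N)"

definition neg_part :: "(real set \<Rightarrow> real) \<Rightarrow> real measure" where
  "neg_part \<mu> = (THE N. \<exists>P. jordan_decomposition \<mu> P N)"

definition msupport :: "real measure \<Rightarrow> real set" where
  "msupport M = {x \<in> I. \<forall>U. open U \<longrightarrow> x \<in> U \<longrightarrow> emeasure M (U \<inter> I) > 0}"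

definition signed_integral :: "(real set \<Rightarrow> real) \<Rightarrow> (real \<Rightarrow> real) \<Rightarrow> real" where
  "signed_integral \<mu> f = integral\<^sup>L (pos_part \<mu>) f - integral\<^sup>L (neg_part \<mu>) f"

definition tv_norm :: "(real set \<Rightarrow> real) \<Rightarrow> ennreal" where
  "tv_norm \<mu> =
     (SUP \<P>\<in>{\<P>. finite \<P> \<and> partition_on I \<P> \<and> \<P> \<subseteq> sets borel_I}. ennreal (\<Sum>A\<in>\<P>. \<bar>\<mu> A\<bar>))"


subsection \<open>Generalized minimal extrapolation\<close>

definition gen_moments :: "(nat \<Rightarrow> real \<Rightarrow> real) \<Rightarrow> nat \<Rightarrow> (real set \<Rightarrow> real) \<Rightarrow> real list" where
  "gen_moments u n \<mu> = map (\<lambda>l. signed_integral \<mu> (u l)) [0..<Suc n]"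

definition minimal_extrapolation ::
    "(nat \<Rightarrow> real \<Rightarrow> real) \<Rightarrow> nat \<Rightarrow> real list \<Rightarrow> (real set \<Rightarrow> real) \<Rightarrow> bool" where
  "minimal_extrapolation u n c \<mu> \<longleftrightarrow>
     signed_measure \<mu> \<and> gen_moments u n \<mu> = c \<and>
     (\<forall>\<nu>. signed_measure \<nu> \<longrightarrow> gen_moments u n \<nu> = c \<longrightarrow> tv_norm \<mu> \<le> tv_norm \<nu>)"

end

theory Submission
  imports Defs "Jordan_Normal_Form.Determinant"
begin

text \<open>
  On \<open>I\<close> we have \<open>\<bar>T\<bar> \<le> 1\<close>, and \<open>T = \<plusminus>1\<close> on the supports of \<open>\<sigma>\<^sup>+\<close> and \<open>\<sigma>\<^sup>-\<close>, so \<open>\<parallel>\<sigma>\<parallel> = \<integral> T d\<sigma> = \<integral> T d\<mu> \<le> \<parallel>\<mu>\<parallel>\<close>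
  for every \<open>\<mu>\<close> with the same moments, and equality forces \<open>\<mu>\<^sup>+\<close> and \<open>\<mu>\<^sup>-\<close> to live on \<open>{T = 1}\<close> and \<open>{T = -1}\<close>.
  The at most \<open>k\<close> zeros of \<open>T\<close> cut \<open>I\<close> into cells \<open>0, \<dots>, k\<close>, and a point is an alternation point iff it is the only
  point of its cell with \<open>\<bar>T\<bar> = 1\<close>. Hence on each cell \<open>\<mu> - \<sigma>\<close> is a multiple \<open>d\<^sub>j\<close> of a
  nonzero positive measure \<open>\<rho>\<^sub>j\<close>. If \<open>d \<noteq> 0\<close>, the matrix \<open>\<integral> u\<^sub>l d\<rho>\<^sub>j\<close> is singular, since \<open>d\<close> is in its kernel.
  Its transpose is then singular as well, which yields a nontrivial combination of \<open>u\<^sub>0, \<dots>, u\<^sub>k\<close> with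
  vanishing integral against every \<open>\<rho>\<^sub>j\<close>, hence with a zero in each of the \<open>k + 1\<close> cells: too many zeros.
\<close>

subsection \<open>Jordan decomposition of signed measures\<close>

lemma space_borel_I: "sets M = sets borel_I \<Longrightarrow> space M = I"
  by (metis sets_eq_imp_space_eq space_restrict_space2 borel_closed closed_atLeastAtMost)

lemma I_in_sets [simp]: "I \<in> sets borel_I"
  by (metis sets.top space_borel_I)

lemma signed_measure_Un:
  assumes "signed_measure \<mu>" "A \<in> sets borel_I" "B \<in> sets borel_I" "A \<inter> B = {}"
  shows "\<mu> (A \<union> B) = \<mu> A + \<mu> B"
proof -
  have "range (binaryset A B) \<subseteq> sets borel_I"
    using assms by (auto simp: range_binaryset_eq)
  moreover have "disjoint_family (binaryset A B)"
    using assms(4) by (auto simp: disjoint_family_on_def binaryset_def)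
  ultimately have "(\<lambda>i. \<mu> (binaryset A B i)) sums \<mu> (\<Union>i. binaryset A B i)"
    using assms(1) unfolding signed_measure_def by blast
  moreover have "(\<lambda>i. \<mu> (binaryset A B i)) sums (\<mu> A + \<mu> B)"
    using assms(1) by (intro binaryset_sums) (simp add: signed_measure_def)
  ultimately show ?thesis
    by (simp add: UN_binaryset_eq sums_unique2)
qed

lemma signed_measure_Diff:
  assumes "signed_measure \<mu>" "A \<in> sets borel_I" "B \<in> sets borel_I" "B \<subseteq> A"
  shows "\<mu> (A - B) = \<mu> A - \<mu> B"
  using signed_measure_Un[of \<mu> B "A - B"] assms by (simp add: Un_absorb1)

text \<open>If \<open>\<mu>\<close> were unbounded, one could repeatedly cut off a piece of mass at least 1 while keeping
  \<open>\<mu>\<close> unbounded on the rest, against the convergence of the sum over the pieces.\<close>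

lemma signed_measure_bounded:
  assumes sm: "signed_measure \<mu>"
  shows "\<exists>K. \<forall>A\<in>sets borel_I. \<bar>\<mu> A\<bar> \<le> K"
proof (rule ccontr)
  define bad where "bad A \<longleftrightarrow> A \<in> sets borel_I \<and> (\<forall>K. \<exists>B\<in>sets borel_I. B \<subseteq> A \<and> \<bar>\<mu> B\<bar> > K)" for A
  assume "\<not> ?thesis"
  then have bad_I: "bad I"
    using sets.sets_into_space[of _ borel_I] unfolding bad_def space_borel_I[OF refl]
    by (meson I_in_sets not_le)
  have step: "\<exists>B. bad B \<and> B \<subseteq> A \<and> \<bar>\<mu> (A - B)\<bar> \<ge> 1" if A: "bad A" for A
  proof -
    \<comment> \<open>The margin \<open>\<bar>\<mu> A\<bar> + 1\<close> gives both \<open>C\<close>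
      and \<open>A - C\<close> mass at least 1 in absolute value, so either one may be cut
      off.\<close>
    obtain C where C: "C \<in> sets borel_I" "C \<subseteq> A" "\<bar>\<mu> C\<bar> > \<bar>\<mu> A\<bar> + 1"
      using A unfolding bad_def by blast
    have AC: "A - C \<in> sets borel_I" "\<mu> (A - C) = \<mu> A - \<mu> C"
      using A C signed_measure_Diff[OF sm] by (auto simp: bad_def)
    \<comment> \<open>Bounds \<open>K\<close> and \<open>L\<close> on the subsets of the two pieces
      would bound every subset of \<open>A\<close> by \<open>K + L\<close>.\<close>
    have "bad C \<or> bad (A - C)"
    proof (rule ccontr)
      assume "\<not> (bad C \<or> bad (A - C))"
      then obtain K L where
        K: "\<And>B. B \<in> sets borel_I \<Longrightarrow> B \<subseteq> C \<Longrightarrow> \<bar>\<mu> B\<bar> \<le> K" and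
        L: "\<And>B. B \<in> sets borel_I \<Longrightarrow> B \<subseteq> A - C \<Longrightarrow> \<bar>\<mu> B\<bar> \<le> L"
        unfolding bad_def using C(1) AC(1) by (meson not_le)
      obtain D where D: "D \<in> sets borel_I" "D \<subseteq> A" "\<bar>\<mu> D\<bar> > K + L"
        using A unfolding bad_def by blast
      have "\<mu> D = \<mu> (D \<inter> C) + \<mu> (D - C)"
        using signed_measure_Un[OF sm, of "D \<inter> C" "D - C"] D(1) C(1) by (auto simp: Int_Diff_Un)
      moreover have "\<bar>\<mu> (D \<inter> C)\<bar> \<le> K" "\<bar>\<mu> (D - C)\<bar> \<le> L"
        using K[of "D \<inter> C"] L[of "D - C"] D C(1) by auto
      ultimately show False using D(3) by linarith
    qed
    then show ?thesis
    proof
      assume "bad C"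
      with C AC show ?thesis by (intro exI[of _ C]) auto
    next
      assume "bad (A - C)"
      moreover have "A - (A - C) = C" using C by blast
      ultimately show ?thesis using C by (intro exI[of _ "A - C"]) auto
    qed
  qed
  obtain f where f: "\<And>n::nat. bad (f n)" "\<And>n. f (Suc n) \<subseteq> f n \<and> \<bar>\<mu> (f n - f (Suc n))\<bar> \<ge> 1"
    using dependent_nat_choice[of "\<lambda>_. bad" "\<lambda>_ A B. B \<subseteq> A \<and> \<bar>\<mu> (A - B)\<bar> \<ge> 1"] bad_I step
    by metis
  have "disjoint_family (\<lambda>n. f n - f (Suc n))"
  proof -
    have "decseq f" using f(2) by (auto simp: decseq_Suc_iff)
    then have "(f m - f (Suc m)) \<inter> (f n - f (Suc n)) = {}" if "m < n" for m n
      using decseqD[of f "Suc m" n] that by auto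
    then show ?thesis
      unfolding disjoint_family_on_def by (metis Int_commute nat_neq_iff)
  qed
  moreover have "range (\<lambda>n. f n - f (Suc n)) \<subseteq> sets borel_I"
    using f(1) by (auto simp: bad_def)
  ultimately have "summable (\<lambda>n. \<mu> (f n - f (Suc n)))"
    using sm unfolding signed_measure_def by (blast intro: sums_summable)
  then have "(\<lambda>n. \<mu> (f n - f (Suc n))) \<longlonglongrightarrow> 0"
    by (rule summable_LIMSEQ_zero)
  then obtain n where "\<bar>\<mu> (f n - f (Suc n))\<bar> < 1"
    using LIMSEQ_D[of _ 0 1] by fastforce
  with f(2)[of n] show False by linarith
qed

text \<open>Subsets of disjoint sets unite to a subset of the union, which gives superadditivity;
  conversely a subset of a countable disjoint union is cut into its traces on the pieces. Truncation
  of negative values by \<open>ennreal\<close> does no harm, because the empty set already competes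
  with value 0.\<close>

lemma signed_measure_sup_additive:
  assumes sm: "signed_measure \<mu>"
  shows "countably_additive (sets borel_I) (\<lambda>A. SUP B\<in>{B\<in>sets borel_I. B \<subseteq> A}. ennreal (\<mu> B))"
proof -
  define F where "F A = (SUP B\<in>{B\<in>sets borel_I. B \<subseteq> A}. ennreal (\<mu> B))" for A
  have "countably_additive (sets borel_I) F"
  proof (rule countably_additiveI)
    fix A :: "nat \<Rightarrow> real set"
    assume A: "range A \<subseteq> sets borel_I" "disjoint_family A" "(\<Union>i. A i) \<in> sets borel_I"
    have upper: "ennreal (\<mu> B) \<le> F C" if "B \<in> sets borel_I" "B \<subseteq> C" for B C
      unfolding F_def using that by (intro SUP_upper) auto
    have super: "F C + F D \<le> F (C \<union> D)" if "C \<inter> D = {}" for C D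
    proof -
      have sum: "ennreal (\<mu> B) + ennreal (\<mu> B') \<le> F (C \<union> D)"
        if "B \<in> sets borel_I" "B \<subseteq> C" "B' \<in> sets borel_I" "B' \<subseteq> D" for B B'
      \<comment> \<open>A negative value becomes 0 under \<open>ennreal\<close>, and then the other
        summand alone has to be bounded.\<close>
      proof (cases "\<mu> B \<ge> 0 \<and> \<mu> B' \<ge> 0")
        case True
        have "B \<inter> B' = {}" using that \<open>C \<inter> D = {}\<close> by blast
        with True have "ennreal (\<mu> B) + ennreal (\<mu> B') = ennreal (\<mu> (B \<union> B'))"
          using signed_measure_Un[OF sm, of B B'] that by (simp add: ennreal_plus)
        also have "\<dots> \<le> F (C \<union> D)"
          using that by (intro upper) auto
        finally show ?thesis .
      next
        case False
        moreover have "ennreal (\<mu> B) \<le> F (C \<union> D)" "ennreal (\<mu> B') \<le> F (C \<union> D)"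
          using that by (blast intro!: upper)+
        ultimately show ?thesis
          by (auto simp: ennreal_neg)
      qed
      have ne: "{B \<in> sets borel_I. B \<subseteq> C} \<noteq> {}" for C
        using sets.empty_sets[of borel_I] by blast
      have "ennreal (\<mu> B) + F D \<le> F (C \<union> D)" if "B \<in> sets borel_I" "B \<subseteq> C" for B
        unfolding F_def[of D] ennreal_SUP_add_right[OF ne]
        by (rule SUP_least) (use sum that in blast)
      then show ?thesis
        unfolding F_def[of C] ennreal_SUP_add_left[OF ne, symmetric]
        by (intro SUP_least) blast
    qed
    have "(\<Sum>i<n. F (A i)) \<le> F (\<Union>i<n. A i)" for n
    proof (induction n)
      case (Suc n)
      have "(\<Union>i<n. A i) \<inter> A n = {}"
        using A(2) unfolding disjoint_family_on_def disjoint_iff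
        by (metis UNIV_I UN_iff lessThan_iff less_irrefl)
      have "(\<Sum>i<Suc n. F (A i)) \<le> F (\<Union>i<n. A i) + F (A n)"
        using Suc by (simp add: add_right_mono)
      also have "\<dots> \<le> F ((\<Union>i<n. A i) \<union> A n)"
        by (rule super) fact
      also have "(\<Union>i<n. A i) \<union> A n = (\<Union>i<Suc n. A i)"
        by (auto simp: lessThan_Suc)
      finally show ?case .
    qed simp
    also have "F (\<Union>i<n. A i) \<le> F (\<Union>i. A i)" for n
      unfolding F_def by (intro SUP_subset_mono) auto
    finally have "(\<Sum>i. F (A i)) \<le> F (\<Union>i. A i)"
      by (intro suminf_le_const) auto
    moreover have "F (\<Union>i. A i) \<le> (\<Sum>i. F (A i))"
      unfolding F_def[of "\<Union>i. A i"]
    proof (intro SUP_least)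
      fix B assume "B \<in> {B \<in> sets borel_I. B \<subseteq> (\<Union>i. A i)}"
      then have B: "B \<in> sets borel_I" "(\<Union>i. B \<inter> A i) = B" by auto
      have "(\<lambda>i. \<mu> (B \<inter> A i)) sums \<mu> (\<Union>i. B \<inter> A i)"
      proof -
        have "range (\<lambda>i. B \<inter> A i) \<subseteq> sets borel_I"
          using A(1) B(1) by auto
        moreover have "disjoint_family (\<lambda>i. B \<inter> A i)"
          using A(2) by (auto simp: disjoint_family_on_def)
        ultimately show ?thesis
          using sm unfolding signed_measure_def by blast
      qed
      then have lim: "(\<lambda>n. \<Sum>i<n. \<mu> (B \<inter> A i)) \<longlonglongrightarrow> \<mu> B"
        unfolding B(2) sums_def .
      have "ennreal (\<Sum>i<n. \<mu> (B \<inter> A i)) \<le> (\<Sum>i. F (A i))" for n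
      proof -
        \<comment> \<open>\<open>ennreal\<close> commutes with sums of nonnegative terms only, hence
          the detour through positive parts.\<close>
        have "ennreal (\<Sum>i<n. \<mu> (B \<inter> A i)) \<le> ennreal (\<Sum>i<n. max 0 (\<mu> (B \<inter> A i)))"
          by (intro ennreal_leI sum_mono) auto
        also have "\<dots> = (\<Sum>i<n. ennreal (max 0 (\<mu> (B \<inter> A i))))"
          by (rule sum_ennreal[symmetric]) simp
        also have "\<dots> = (\<Sum>i<n. ennreal (\<mu> (B \<inter> A i)))"
          by (intro sum.cong) (auto simp: max_def ennreal_neg)
        also have "\<dots> \<le> (\<Sum>i<n. F (A i))"
          using A(1) B(1) by (intro sum_mono upper) auto
        also have "\<dots> \<le> (\<Sum>i. F (A i))"
          by (intro sum_le_suminf) auto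
        finally show ?thesis .
      qed
      then show "ennreal (\<mu> B) \<le> (\<Sum>i. F (A i))"
        using tendsto_ennrealI[OF lim] by (intro LIMSEQ_le_const2) auto
    qed
    ultimately show "(\<Sum>i. F (A i)) = F (\<Union>i. A i)" by (rule antisym)
  qed
  then show ?thesis unfolding F_def[abs_def] .
qed

text \<open>The positive part is \<open>P A = sup {\<mu> B | B \<subseteq> A}\<close>; the Hahn decomposition of the pair \<open>P\<close>, \<open>P - \<mu>\<close>
  of ordinary measures is the one of \<open>\<mu>\<close>.\<close>

lemma jordan_decomposition_exists:
  assumes sm: "signed_measure \<mu>"
  shows "\<exists>P N. jordan_decomposition \<mu> P N"
proof -
  define F where "F A = (SUP B\<in>{B\<in>sets borel_I. B \<subseteq> A}. ennreal (\<mu> B))" for A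
  have F_ge: "ennreal (\<mu> B) \<le> F A" if "B \<in> sets borel_I" "B \<subseteq> A" for A B
    unfolding F_def using that by (intro SUP_upper) auto
  obtain K where K: "\<And>A. A \<in> sets borel_I \<Longrightarrow> \<bar>\<mu> A\<bar> \<le> K"
    using signed_measure_bounded[OF sm] by blast
  have F_finite: "F A \<noteq> \<infinity>" for A
  proof -
    have "F A \<le> ennreal K"
      unfolding F_def using K by (intro SUP_least ennreal_leI) (fastforce simp: abs_le_iff)
    then show ?thesis by (auto simp: top_unique)
  qed
  have sa: "sigma_algebra I (sets borel_I)"
    using sets.sigma_algebra_axioms[of borel_I] by (simp add: space_borel_I)
  have F_empty: "F {} = 0"
  proof -
    have "{B \<in> sets borel_I. B \<subseteq> {}} = {{}}" by auto
    then show ?thesis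
      unfolding F_def using sm by (simp add: signed_measure_def)
  qed
  define P where "P = measure_of I (sets borel_I) F"
  have sets_P: "sets P = sets borel_I"
    unfolding P_def using sa by (simp add: sigma_algebra.sets_measure_of_eq)
  have emP: "emeasure P A = F A" if "A \<in> sets borel_I" for A
    unfolding P_def using sa F_empty signed_measure_sup_additive[OF sm] that
    by (intro emeasure_measure_of_sigma) (auto simp: positive_def F_def[abs_def])
  have finP: "finite_measure P"
    using F_finite emP by (intro finite_measureI) (auto simp: sets_P space_borel_I)
  interpret P: finite_measure P by (rule finP)
  have P_ge: "\<mu> B \<le> measure P A" if "B \<in> sets borel_I" "A \<in> sets borel_I" "B \<subseteq> A" for A B
  proof -
    have "ennreal (\<mu> B) \<le> ennreal (measure P A)"
      using F_ge[of B A] emP[of A] that by (simp add: P.emeasure_eq_measure)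
    then show ?thesis by (simp add: ennreal_le_iff)
  qed
  \<comment> \<open>The candidate for the negative part; by \<open>P_ge\<close> the difference is
    nonnegative on measurable sets, so \<open>ennreal\<close> loses nothing.\<close>
  define G where "G A = ennreal (measure P A - \<mu> A)" for A
  have "countably_additive (sets borel_I) G"
  proof (rule countably_additiveI)
    fix A :: "nat \<Rightarrow> real set"
    assume A: "range A \<subseteq> sets borel_I" "disjoint_family A" "(\<Union>i. A i) \<in> sets borel_I"
    have "(\<lambda>i. measure P (A i)) sums measure P (\<Union>i. A i)"
      using A by (intro P.finite_measure_UNION) (auto simp: sets_P)
    moreover have "(\<lambda>i. \<mu> (A i)) sums \<mu> (\<Union>i. A i)"
      using sm A unfolding signed_measure_def by blast
    ultimately have "(\<lambda>i. measure P (A i) - \<mu> (A i)) sums (measure P (\<Union>i. A i) - \<mu> (\<Union>i. A i))"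
      by (rule sums_diff)
    then show "(\<Sum>i. G (A i)) = G (\<Union>i. A i)"
      unfolding G_def using P_ge A(1)
      by (subst suminf_ennreal2) (auto simp: sums_iff)
  qed
  moreover have "G {} = 0"
    using sm by (simp add: G_def signed_measure_def)
  moreover define N where "N = measure_of I (sets borel_I) G"
  ultimately have emN: "emeasure N A = G A" if "A \<in> sets borel_I" for A
    using sa that by (simp add: emeasure_measure_of_sigma positive_def)
  have sets_N: "sets N = sets borel_I"
    unfolding N_def using sa by (simp add: sigma_algebra.sets_measure_of_eq)
  have finN: "finite_measure N"
    using emN by (intro finite_measureI) (auto simp: sets_N space_borel_I G_def)
  interpret N: finite_measure N by (rule finN)
  have N: "measure N A = measure P A - \<mu> A" if "A \<in> sets borel_I" for A
    using emN[OF that] P_ge[OF that that] by (simp add: G_def N.emeasure_eq_measure)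
  obtain H where H: "H \<in> sets borel_I"
    "\<And>X. X \<in> sets borel_I \<Longrightarrow> X \<subseteq> H \<Longrightarrow> N X \<le> P X"
    "\<And>X. X \<in> sets borel_I \<Longrightarrow> X \<inter> H = {} \<Longrightarrow> P X \<le> N X"
    using finite_unsigned_Hahn_decomposition[OF finP finN] sets_P sets_N by auto
  have pos: "0 \<le> \<mu> X" if "X \<in> sets borel_I" "X \<subseteq> H" for X
    using H(2)[OF that] N[OF that(1)] by (simp add: N.emeasure_eq_measure P.emeasure_eq_measure)
  have neg: "\<mu> X \<le> 0" if "X \<in> sets borel_I" "X \<inter> H = {}" for X
  proof -
    have "measure P X \<le> measure N X"
      using H(3)[OF that] by (simp add: N.emeasure_eq_measure P.emeasure_eq_measure)
    then show ?thesis using N[OF that(1)] by simp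
  qed
  \<comment> \<open>On \<open>H\<close> the function \<open>\<mu>\<close> is nonnegative and
    therefore monotone, so the supremum is attained at \<open>H\<close> itself. Hence
    \<open>P\<close> and \<open>\<mu>\<close> agree at \<open>H\<close>, and \<open>N\<close>
    vanishes there.\<close>
  have "F H \<le> ennreal (\<mu> H)"
    unfolding F_def
  proof (intro SUP_least ennreal_leI)
    fix B assume "B \<in> {B \<in> sets borel_I. B \<subseteq> H}"
    then show "\<mu> B \<le> \<mu> H"
      using pos[of "H - B"] signed_measure_Diff[OF sm H(1), of B] H(1) by auto
  qed
  then have "ennreal (measure P H) \<le> ennreal (\<mu> H)"
    unfolding emP[OF H(1), symmetric] P.emeasure_eq_measure .
  then have "measure P H \<le> \<mu> H"
    using pos[OF H(1)] by simp
  then have "emeasure N H = 0"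
    using emN[OF H(1)] by (simp add: G_def ennreal_neg)
  moreover have "F (I - H) = 0"
    unfolding F_def using neg by (intro antisym SUP_least) (auto simp: ennreal_neg disjoint_iff subset_iff)
  then have "emeasure P (I - H) = 0"
    using emP[OF sets.Diff[OF I_in_sets H(1)]] by simp
  ultimately have "jordan_decomposition \<mu> P N"
    unfolding jordan_decomposition_def
    using sets_P sets_N finP finN H(1) N by auto
  then show ?thesis by blast
qed

text \<open>\<open>P\<close> is concentrated on a set \<open>H\<close> that is null for
  \<open>N\<close>, so \<open>P\<close> of \<open>A\<close> is \<open>\<mu> (A \<inter> H)\<close>,
  which no other decomposition can undercut. Exchanging the roles gives uniqueness.\<close>

lemma jordan_decomposition_le:
  assumes "jordan_decomposition \<mu> P N" "jordan_decomposition \<mu> P' N'" "A \<in> sets borel_I"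
  shows "measure P A \<le> measure P' A"
proof -
  from assms(1) obtain H where H: "H \<in> sets borel_I" "emeasure N H = 0" "emeasure P (I - H) = 0"
    and sets: "sets P = sets borel_I" "sets N = sets borel_I" and fin: "finite_measure P"
    and \<mu>: "\<And>A. A \<in> sets borel_I \<Longrightarrow> \<mu> A = measure P A - measure N A"
    unfolding jordan_decomposition_def by auto
  from assms(2) have sets': "sets P' = sets borel_I" and fin': "finite_measure P'"
    and \<mu>': "\<And>A. A \<in> sets borel_I \<Longrightarrow> \<mu> A = measure P' A - measure N' A"
    unfolding jordan_decomposition_def by auto
  have AI: "A \<subseteq> I" using assms(3) sets.sets_into_space[of A borel_I] by (simp add: space_borel_I)
  have "emeasure P (A - H) \<le> emeasure P (I - H)"
    using AI H(1) sets by (intro emeasure_mono) auto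
  then have "measure P A = measure P (A \<inter> H)"
    using finite_measure.finite_measure_Diff'[OF fin, of A H] assms(3) H(1,3) sets
    by (simp add: measure_def)
  also have "measure N (A \<inter> H) = 0"
  proof -
    have "emeasure N (A \<inter> H) \<le> emeasure N H"
      using H(1) sets by (intro emeasure_mono) auto
    then show ?thesis using H(2) by (simp add: measure_def)
  qed
  then have "measure P (A \<inter> H) = \<mu> (A \<inter> H)"
    using \<mu>[of "A \<inter> H"] H(1) assms(3) by simp
  also have "\<dots> \<le> measure P' (A \<inter> H)"
    using \<mu>'[of "A \<inter> H"] H(1) assms(3) by simp
  also have "\<dots> \<le> measure P' A"
    using H(1) assms(3) sets' by (intro finite_measure.finite_measure_mono[OF fin']) auto
  finally show ?thesis .
qed

lemma jordan_decomposition_unique: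
  assumes "jordan_decomposition \<mu> P N" "jordan_decomposition \<mu> P' N'"
  shows "P' = P" "N' = N"
proof -
  have fin: "finite_measure P" "finite_measure P'" "finite_measure N" "finite_measure N'"
    and sets: "sets P = sets borel_I" "sets P' = sets borel_I"
      "sets N = sets borel_I" "sets N' = sets borel_I"
    using assms unfolding jordan_decomposition_def by auto
  have P: "measure P' A = measure P A" if "A \<in> sets borel_I" for A
    using jordan_decomposition_le[OF assms that] jordan_decomposition_le[OF assms(2,1) that]
    by (rule antisym[rotated])
  then show "P' = P"
    using fin sets by (intro measure_eqI) (auto simp: finite_measure.emeasure_eq_measure)
  have "measure N' A = measure N A" if "A \<in> sets borel_I" for A
    using assms P[OF that] that unfolding jordan_decomposition_def by fastforce
  then show "N' = N"
    using fin sets by (intro measure_eqI) (auto simp: finite_measure.emeasure_eq_measure)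
qed

text \<open>Existence and uniqueness together justify the definite descriptions behind
  \<open>pos_part\<close> and \<open>neg_part\<close>.\<close>

lemma jordan_decomposition_parts:
  assumes "signed_measure \<mu>"
  shows "jordan_decomposition \<mu> (pos_part \<mu>) (neg_part \<mu>)"
proof -
  obtain P N where PN: "jordan_decomposition \<mu> P N"
    using jordan_decomposition_exists[OF assms] by blast
  have "pos_part \<mu> = P" "neg_part \<mu> = N"
    unfolding pos_part_def neg_part_def using PN jordan_decomposition_unique[OF PN]
    by (blast intro!: the_equality)+
  with PN show ?thesis by simp
qed

section \<open>Total variation norm and support\<close>

text \<open>Summing \<open>\<bar>\<mu> A\<bar> \<le> measure P A + measure N A\<close> over a
  partition bounds the supremum, and the Hahn partition into \<open>H\<close> and
  \<open>I - H\<close> attains it.\<close>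

lemma tv_norm_jordan:
  assumes "jordan_decomposition \<mu> P N"
  shows "tv_norm \<mu> = ennreal (measure P I + measure N I)"
proof -
  from assms obtain H where H: "H \<in> sets borel_I" "emeasure N H = 0" "emeasure P (I - H) = 0"
    and sets: "sets P = sets borel_I" "sets N = sets borel_I"
    and fin: "finite_measure P" "finite_measure N"
    and \<mu>: "\<And>A. A \<in> sets borel_I \<Longrightarrow> \<mu> A = measure P A - measure N A"
    unfolding jordan_decomposition_def by auto
  have HI: "H \<subseteq> I" using H(1) sets.sets_into_space[of H borel_I] by (simp add: space_borel_I)
  have split: "measure M I = measure M H + measure M (I - H)"
    if "finite_measure M" "sets M = sets borel_I" for M
    using finite_measure.finite_measure_Diff[OF that(1), of I H] that(2) H(1) HI by simp
  show ?thesis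
    unfolding tv_norm_def
  proof (rule antisym, rule SUP_least)
    fix \<P> assume "\<P> \<in> {\<P>. finite \<P> \<and> partition_on I \<P> \<and> \<P> \<subseteq> sets borel_I}"
    then have \<P>: "finite \<P>" "\<Union>\<P> = I" "disjoint \<P>" "\<P> \<subseteq> sets borel_I"
      by (auto simp: partition_on_def)
    have total: "(\<Sum>A\<in>\<P>. measure M A) = measure M I"
      if "finite_measure M" "sets M = sets borel_I" for M
      using finite_measure.finite_measure_finite_Union[OF that(1) \<P>(1), of "\<lambda>A. A"] \<P> that(2)
      by (simp add: disjoint_family_on_def disjoint_def)
    have "(\<Sum>A\<in>\<P>. \<bar>\<mu> A\<bar>) \<le> (\<Sum>A\<in>\<P>. measure P A + measure N A)"
    proof (rule sum_mono)
      fix A assume "A \<in> \<P>"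
      then have "\<mu> A = measure P A - measure N A" using \<P>(4) \<mu> by blast
      then show "\<bar>\<mu> A\<bar> \<le> measure P A + measure N A"
        using measure_nonneg[of P A] measure_nonneg[of N A] by linarith
    qed
    also have "\<dots> = measure P I + measure N I"
      using total fin sets by (simp add: sum.distrib)
    finally show "ennreal (\<Sum>A\<in>\<P>. \<bar>\<mu> A\<bar>) \<le> ennreal (measure P I + measure N I)"
      by (rule ennreal_leI)
  next
    \<comment> \<open>Blocks of a partition are nonempty, so an empty \<open>H\<close> or
      \<open>I - H\<close> is dropped; it contributes \<open>\<mu> {} = 0\<close>.\<close>
    define \<P> where "\<P> = {H, I - H} - {{}}"
    have "measure P I + measure N I = \<bar>\<mu> H\<bar> + \<bar>\<mu> (I - H)\<bar>"
      using split[OF fin(1) sets(1)] split[OF fin(2) sets(2)] \<mu>[of H] \<mu>[of "I - H"] H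
        sets.Diff[OF I_in_sets H(1)]
      by (simp add: measure_def)
    also have "\<dots> = (\<Sum>A\<in>{H, I - H}. \<bar>\<mu> A\<bar>)"
    proof -
      \<comment> \<open>The two sets must be distinct, otherwise the sum over
        \<open>{H, I - H}\<close> would have a single term.\<close>
      have "(0::real) \<in> I" by simp
      then have "H \<noteq> I - H" by blast
      then show ?thesis by simp
    qed
    also have "\<dots> = (\<Sum>A\<in>\<P>. \<bar>\<mu> A\<bar>)"
      unfolding \<P>_def using \<mu>[of "{}"] by (intro sum.mono_neutral_right) auto
    finally have "ennreal (measure P I + measure N I) = ennreal (\<Sum>A\<in>\<P>. \<bar>\<mu> A\<bar>)"
      by simp
    also have "\<dots> \<le> (SUP \<P>\<in>{\<P>. finite \<P> \<and> partition_on I \<P> \<and> \<P> \<subseteq> sets borel_I}.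
        ennreal (\<Sum>A\<in>\<P>. \<bar>\<mu> A\<bar>))"
      unfolding \<P>_def using HI H(1)
      by (intro SUP_upper) (auto simp: partition_on_def disjoint_def)
    finally show "ennreal (measure P I + measure N I) \<le> \<dots>" .
  qed
qed

text \<open>The complement of the support is covered by open sets of measure zero; by Lindelof
  countably many of them suffice.\<close>

lemma emeasure_outside_support:
  assumes "sets M = sets borel_I"
  shows "emeasure M (I - msupport M) = 0" "I - msupport M \<in> sets borel_I"
proof -
  define \<U> where "\<U> = {U. open U \<and> emeasure M (U \<inter> I) = 0}"
  obtain \<V> where \<V>: "\<V> \<subseteq> \<U>" "countable \<V>" "\<Union>\<V> = \<Union>\<U>"
    using Lindelof[of \<U>] unfolding \<U>_def by blast
  have "I - msupport M = I \<inter> \<Union>\<U>"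
    unfolding msupport_def \<U>_def by (auto simp: zero_less_iff_neq_zero)
  then have eq: "I - msupport M = (\<Union>U\<in>\<V>. U \<inter> I)"
    unfolding \<V>(3)[symmetric] by blast
  have null: "U \<inter> I \<in> null_sets M" if "U \<in> \<V>" for U
  proof (rule null_setsI)
    have U: "open U" "emeasure M (U \<inter> I) = 0"
      using that \<V>(1) by (auto simp: \<U>_def)
    have "I \<inter> U \<in> sets borel_I"
      unfolding sets_restrict_space using U(1) by (intro imageI) simp
    then show "U \<inter> I \<in> sets M"
      by (simp only: assms Int_commute)
    show "emeasure M (U \<inter> I) = 0" by fact
  qed
  have "I - msupport M \<in> null_sets M"
    unfolding eq using \<V>(2) null by (rule null_sets_UN')
  then show "emeasure M (I - msupport M) = 0" "I - msupport M \<in> sets borel_I"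
    unfolding assms[symmetric] by (rule null_setsD1, rule null_setsD2)
qed

subsection \<open>Cells of a Chebyshev polynomial\<close>

text \<open>A nonzero kernel vector makes the determinant vanish, and the transpose has the same
  determinant.\<close>

lemma square_kernel_transpose:
  fixes M :: "nat \<Rightarrow> nat \<Rightarrow> real"
  assumes "\<And>i. i < n \<Longrightarrow> (\<Sum>j<n. M i j * d j) = 0" and "j < n" "d j \<noteq> 0"
  shows "\<exists>a. (\<exists>i<n. a i \<noteq> 0) \<and> (\<forall>j<n. (\<Sum>i<n. a i * M i j) = 0)"
proof -
  define A where "A = Matrix.mat n n (\<lambda>(i, j). M i j)"
  have A: "A \<in> carrier_mat n n" "transpose_mat A \<in> carrier_mat n n"
    by (simp_all add: A_def)
  have "A *\<^sub>v Matrix.vec n d = 0\<^sub>v n"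
    using assms(1) by (intro eq_vecI) (auto simp: A_def scalar_prod_def lessThan_atLeast0)
  moreover have "Matrix.vec n d \<noteq> 0\<^sub>v n"
    using assms(2,3) by (metis index_vec index_zero_vec(1))
  ultimately have "Determinant.det A = 0"
    using det_0_iff_vec_prod_zero_field[OF A(1)] vec_carrier by blast
  then have "Determinant.det (transpose_mat A) = 0"
    using Determinant.det_transpose[OF A(1)] by simp
  then obtain v where v: "v \<in> carrier_vec n" "v \<noteq> 0\<^sub>v n" "transpose_mat A *\<^sub>v v = 0\<^sub>v n"
    using det_0_iff_vec_prod_zero_field[OF A(2)] by blast
  have "\<exists>i<n. vec_index v i \<noteq> 0"
    using v(1,2) by (metis carrier_vecD eq_vecI index_zero_vec(1) index_zero_vec(2))
  moreover have "(\<Sum>i<n. vec_index v i * M i j) = 0" if "j < n" for j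
  proof -
    have "(\<Sum>i<n. vec_index v i * M i j) = vec_index (transpose_mat A *\<^sub>v v) j"
      using v(1) that by (auto simp: A_def scalar_prod_def lessThan_atLeast0 intro!: sum.cong)
    then show ?thesis
      using v(3) that by simp
  qed
  ultimately show ?thesis by blast
qed

text \<open>The number of zeros of \<open>T\<close> to the left of \<open>t\<close> splits \<open>I\<close> into \<open>k + 1\<close> intervals, on each of which
  \<open>T\<close> has constant sign off its zeros.\<close>

definition zeros :: "(real \<Rightarrow> real) \<Rightarrow> real set" where
  "zeros T = {t\<in>I. T t = 0}"

definition cell :: "(real \<Rightarrow> real) \<Rightarrow> real \<Rightarrow> nat" where
  "cell T t = card {z\<in>zeros T. z < t}"

definition extremal :: "(real \<Rightarrow> real) \<Rightarrow> nat \<Rightarrow> real set" where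
  "extremal T j = {t\<in>I. \<bar>T t\<bar> = 1 \<and> cell T t = j}"

lemma cell_mono: "finite (zeros T) \<Longrightarrow> s \<le> t \<Longrightarrow> cell T s \<le> cell T t"
  unfolding cell_def by (intro card_mono) auto

lemma cell_le: "finite (zeros T) \<Longrightarrow> cell T t \<le> card (zeros T)"
  unfolding cell_def by (intro card_mono) auto

text \<open>The intermediate value theorem in a form that does not fix the order of \<open>a\<close>
  and \<open>b\<close>.\<close>

lemma zero_between:
  fixes f :: "real \<Rightarrow> real"
  assumes "continuous_on I f" "a \<in> I" "b \<in> I" "f a \<le> 0" "0 \<le> f b"
  shows "\<exists>z\<in>I. f z = 0 \<and> min a b \<le> z \<and> z \<le> max a b"
proof (cases "a \<le> b")
  case True
  have "continuous_on {a..b} f"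
    by (rule continuous_on_subset[OF assms(1)]) (use assms(2,3) in auto)
  then obtain z where "a \<le> z" "z \<le> b" "f z = 0"
    using IVT'[of f a 0 b] assms True by blast
  then show ?thesis using assms(2,3) True by (intro bexI[of _ z]) auto
next
  case False
  have "continuous_on {b..a} f"
    by (rule continuous_on_subset[OF assms(1)]) (use assms(2,3) in auto)
  then obtain z where "b \<le> z" "z \<le> a" "f z = 0"
    using IVT2'[of f a 0 b] assms False by force
  then show ?thesis using assms(2,3) False by (intro bexI[of _ z]) auto
qed

text \<open>Since \<open>cell T\<close> is monotone, everything between two points of one cell lies
  in that cell, in particular the zero from the intermediate value theorem.\<close>

lemma cell_zero:
  fixes f :: "real \<Rightarrow> real"
  assumes "continuous_on I f" "a \<in> I" "b \<in> I" "f a \<le> 0" "0 \<le> f b"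
    and "finite (zeros T)" "cell T a = j" "cell T b = j"
  shows "\<exists>z\<in>I. f z = 0 \<and> cell T z = j"
proof -
  obtain z where z: "z \<in> I" "f z = 0" "min a b \<le> z" "z \<le> max a b"
    using zero_between[OF assms(1-5)] by blast
  then have "cell T (min a b) \<le> cell T z" "cell T z \<le> cell T (max a b)"
    using cell_mono[OF assms(6)] by auto
  moreover have "cell T (min a b) = j" "cell T (max a b) = j"
    using assms(7,8) by (auto simp: min_def max_def)
  ultimately have "cell T z = j" by simp
  with z show ?thesis by blast
qed

text \<open>A sign change yields a zero of \<open>T\<close> between \<open>s\<close> and
  \<open>t\<close>. It differs from \<open>t\<close> because \<open>T t\<close> is nonzero, so the
  strict count at \<open>t\<close> includes it, while the count at \<open>s\<close> does
  not.\<close>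

lemma cell_less:
  assumes "continuous_on I T" "finite (zeros T)" "s \<in> I" "t \<in> I" "s < t" "T s * T t < 0"
  shows "cell T s < cell T t"
proof -
  have "\<exists>z\<in>I. T z = 0 \<and> s \<le> z \<and> z \<le> t"
    using zero_between[OF assms(1,3,4)] zero_between[OF assms(1,4,3)] assms(5,6)
    by (auto simp: mult_less_0_iff)
  then obtain z where z: "z \<in> zeros T" "s \<le> z" "z \<le> t" "T z = 0"
    by (auto simp: zeros_def)
  have "z \<noteq> t" using z(4) assms(6) by auto
  then have "z \<in> {z\<in>zeros T. z < t}" "z \<notin> {z\<in>zeros T. z < s}"
    using z(1-3) by simp_all
  moreover have "{z\<in>zeros T. z < s} \<subseteq> {z\<in>zeros T. z < t}"
    using assms(5) by (simp add: Collect_mono_iff)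
  ultimately have "{z\<in>zeros T. z < s} \<subset> {z\<in>zeros T. z < t}"
    by blast
  then show ?thesis
    unfolding cell_def using assms(2) by (intro psubset_card_mono) auto
qed

lemma same_cell_same_sign:
  assumes "continuous_on I T" "finite (zeros T)" "s \<in> I" "t \<in> I" "cell T s = cell T t"
  shows "0 \<le> T s * T t"
  using cell_less[OF assms(1,2), of s t] cell_less[OF assms(1,2), of t s] assms(3-5)
  by (metis less_irrefl linorder_neqE mult.commute not_le not_square_less_zero)

lemma cell_sets:
  assumes "finite (zeros T)"
  shows "{t. cell T t = j} \<in> sets borel"
proof -
  have "mono (\<lambda>t. real (cell T t))"
    using cell_mono[OF assms] by (intro monoI) auto
  then have "(\<lambda>t. real (cell T t)) \<in> borel_measurable borel"
    by (rule borel_measurable_mono)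
  then have "(\<lambda>t. real (cell T t)) -` {real j} \<inter> space borel \<in> sets borel"
    by (rule measurable_sets) auto
  then show ?thesis by (simp add: vimage_def)
qed

lemma extremal_sets:
  assumes "continuous_on I T" "finite (zeros T)"
  shows "extremal T j \<in> sets borel_I"
proof -
  have "{t\<in>I. \<bar>T t\<bar> = 1} = (\<lambda>t. \<bar>T t\<bar>) -` {1} \<inter> I" by auto
  moreover have "closed \<dots>"
    using assms(1) by (intro continuous_closed_preimage continuous_intros) auto
  ultimately have "{t\<in>I. \<bar>T t\<bar> = 1} \<in> sets borel" by simp
  then have "{t\<in>I. \<bar>T t\<bar> = 1} \<inter> {t. cell T t = j} \<in> sets borel"
    using cell_sets[OF assms(2)] by (rule sets.Int)
  moreover have "extremal T j = {t\<in>I. \<bar>T t\<bar> = 1} \<inter> {t. cell T t = j}"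
    by (auto simp: extremal_def)
  ultimately have "extremal T j \<in> sets borel" by metis
  moreover have "extremal T j \<subseteq> I" by (auto simp: extremal_def)
  ultimately show ?thesis
    by (subst sets_restrict_space_iff) simp_all
qed

section \<open>Alternation points and cells\<close>

text \<open>Consecutive points of an alternation have opposite signs, so the cell number strictly
  increases along the \<open>k + 1\<close> points. Only the numbers \<open>0\<close> to
  \<open>k\<close> are available, hence each point gets its own index.\<close>

lemma alternation_cell:
  assumes "continuous_on I T" "finite (zeros T)" "card (zeros T) \<le> k"
    and alt: "alternation T k x" and "sup_norm T = 1" and "j \<le> k"
  shows "cell T (x j) = j"
proof -
  have lt: "cell T (x i) < cell T (x (Suc i))" if "i < k" for i
  proof -
    have "\<bar>T (x i)\<bar> = 1" "T (x (Suc i)) = - T (x i)"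
      using alt that assms(5) by (auto simp: alternation_def)
    then have "T (x i) * T (x (Suc i)) < 0"
      by (auto simp: abs_if split: if_splits)
    then show ?thesis
      using alt that by (intro cell_less[OF assms(1,2)]) (auto simp: alternation_def)
  qed
  have ge: "j \<le> cell T (x j)" if "j \<le> k" for j
    using that
  proof (induction j)
    case (Suc j)
    then show ?case using lt[of j] by simp
  qed simp
  \<comment> \<open>Each of the remaining \<open>k - j\<close> steps raises the cell number by at
    least 1; this gives the upper bound on \<open>cell T (x j)\<close>.\<close>
  have "cell T (x j) + (k - j) \<le> cell T (x k)"
    using assms(6)
  proof (induction rule: inc_induct)
    case (step i)
    then show ?case using lt[of i] by simp
  qed simp
  also have "\<dots> \<le> k"
    using cell_le[OF assms(2)] assms(3) by (rule order_trans)
  finally show ?thesis using ge[OF assms(6)] assms(6) by linarith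
qed

text \<open>The definition of \<open>alternation\<close> states the modulus for indices below
  \<open>k\<close> only; the last point inherits it from its predecessor, which exists because
  \<open>1 \<le> k\<close>.\<close>

lemma alternation_abs:
  assumes "alternation T k x" "sup_norm T = 1" "1 \<le> k" "j \<le> k"
  shows "\<bar>T (x j)\<bar> = 1"
proof (cases "j < k")
  case True
  then show ?thesis using assms(1,2) by (simp add: alternation_def)
next
  case False
  then have "j = Suc (k - 1)" "k - 1 < k" using assms(3,4) by auto
  then show ?thesis
    using assms(1,2) unfolding alternation_def by (metis abs_minus_cancel)
qed

text \<open>Any other extremal point of the cell could replace \<open>x j\<close>, producing an
  alternation that misses \<open>x j\<close>; but \<open>t = x j\<close> must occur in every
  alternation.\<close>

lemma alternation_points_extremal:
  assumes "continuous_on I T" "finite (zeros T)" "card (zeros T) \<le> k"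
    and alt: "alternation T k x" and norm: "sup_norm T = 1" and k: "1 \<le> k"
    and t: "t \<in> alternation_points T k" "t \<in> extremal T j"
  shows "extremal T j = {x j}"
proof -
  have cell: "cell T (x i) = i" if "i \<le> k" for i
    by (rule alternation_cell[OF assms(1-5) that])
  obtain i where "i \<le> k" "t = x i"
    using t(1) alt by (auto simp: alternation_points_def)
  with t(2) cell have j: "j \<le> k" "t = x j" by (auto simp: extremal_def)
  have "s = x j" if s: "s \<in> extremal T j" for s
  proof -
    have abs: "\<bar>T s\<bar> = 1" "\<bar>T (x j)\<bar> = 1" "s \<in> I" "x j \<in> I" "cell T s = j"
      using s alternation_abs[OF alt norm k j(1)] alt j(1)
      by (auto simp: extremal_def alternation_def)
    then have Ts: "T s = T (x j)"
      using same_cell_same_sign[OF assms(1,2), of s "x j"] cell[OF j(1)]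
      by (auto simp: abs_if split: if_splits)
    have less: "a < b" if "cell T a < cell T b" for a b
      using cell_mono[OF assms(2), of b a] that by fastforce
    \<comment> \<open>Order is preserved because cell numbers decide it, and values because
      \<open>T\<close> has one sign on the extremal points of a cell.\<close>
    have "alternation T k (x(j := s))"
      unfolding alternation_def
    proof (intro conjI allI impI)
      fix i assume "i \<le> k"
      then show "(x(j := s)) i \<in> I" using abs alt by (auto simp: alternation_def)
    next
      fix i assume i: "i < k"
      show "(x(j := s)) i < (x(j := s)) (Suc i)"
        using i cell abs(5) by (intro less) auto
      have T: "T ((x(j := s)) l) = T (x l)" for l using Ts by simp
      show "T ((x(j := s)) (Suc i)) = - T ((x(j := s)) i)" "\<bar>T ((x(j := s)) i)\<bar> = sup_norm T"
        unfolding T using alt i by (auto simp: alternation_def)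
    qed
    then have "x j \<in> (x(j := s)) ` {..k}"
      using t(1) unfolding j(2) alternation_points_def by blast
    then obtain i where i: "i \<le> k" "x j = (x(j := s)) i" by auto
    show ?thesis
    \<comment> \<open>An index \<open>i\<close> other than \<open>j\<close> would place
      \<open>x j\<close> in two different cells; so \<open>i = j\<close>, which reads
      \<open>x j = s\<close>.\<close>
    proof (cases "i = j")
      case False
      with i cell[OF i(1)] cell[OF j(1)] show ?thesis by auto
    qed (use i in simp)
  qed
  then show ?thesis using t(2) j(2) by blast
qed

subsection \<open>Functionals on the cells\<close>

lemma borel_measurable_continuous_I:
  fixes f :: "real \<Rightarrow> real"
  assumes "sets M = sets borel_I" "continuous_on I f"
  shows "f \<in> borel_measurable M"
  using borel_measurable_continuous_on_restrict[OF assms(2)]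
  by (simp only: measurable_cong_sets[OF assms(1) refl])

lemma integrable_continuous_I:
  fixes f :: "real \<Rightarrow> real"
  assumes "finite_measure M" "sets M = sets borel_I" "continuous_on I f"
  shows "integrable M f"
proof -
  have "bounded (f ` I)"
    using assms(3) by (intro compact_imp_bounded compact_continuous_image) auto
  then obtain B where "\<And>x. x \<in> I \<Longrightarrow> norm (f x) \<le> B"
    unfolding bounded_iff by blast
  then have "AE x in M. norm (f x) \<le> B"
    by (intro AE_I2) (simp only: space_borel_I[OF assms(2)])
  then show ?thesis
    by (rule finite_measure.integrable_const_bound[OF assms(1)])
      (rule borel_measurable_continuous_I[OF assms(2,3)])
qed

lemma integrable_indicator_times:
  fixes f :: "real \<Rightarrow> real"
  assumes "integrable M f" "D \<in> sets M"
  shows "integrable M (\<lambda>x. indicator D x * f x)"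
  using integrable_mult_indicator[OF assms(2,1)] by simp

lemma integral_indicator_null:
  fixes f :: "real \<Rightarrow> real"
  assumes "emeasure M D = 0" "D \<in> sets M"
  shows "(\<integral>x. indicator D x * f x \<partial>M) = 0"
proof -
  have "AE x in M. x \<notin> D"
    using assms by (intro AE_not_in) (auto intro: null_setsI)
  then show ?thesis
    by (intro integral_eq_zero_AE) (auto elim!: eventually_mono)
qed

lemma integral_indicator_singleton:
  fixes f :: "real \<Rightarrow> real"
  assumes "{y} \<in> sets M"
  shows "(\<integral>x. indicator {y} x * f x \<partial>M) = f y * measure M {y}"
proof -
  have "(\<lambda>x. indicator {y} x * f x) = (\<lambda>x. f y * indicator {y} x)"
    by (auto simp: indicator_def)
  moreover have "{y} \<inter> space M = {y}" using sets.sets_into_space[OF assms] by blast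
  ultimately show ?thesis
    by simp
qed

text \<open>A function positive on a set of positive measure has positive integral over it. Applied
  to \<open>f\<close> and \<open>- f\<close>, this supplies points with values of both
  signs.\<close>

lemma integral_zero_imp_nonpos:
  fixes f :: "real \<Rightarrow> real"
  assumes "integrable M f" "D \<in> sets M" "emeasure M D \<noteq> 0"
    and zero: "(\<integral>x. indicator D x * f x \<partial>M) = 0"
  shows "\<exists>a\<in>D. f a \<le> 0"
proof (rule ccontr)
  assume "\<not> ?thesis"
  then have pos: "f a > 0" if "a \<in> D" for a using that by force
  then have "AE x in M. 0 \<le> indicator D x * f x"
    by (intro AE_I2) (auto simp: indicator_def intro: less_imp_le)
  with zero have "AE x in M. indicator D x * f x = 0"
    using integral_nonneg_eq_0_iff_AE[OF integrable_indicator_times[OF assms(1,2)]] by blast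
  then have "AE x in M. x \<notin> D"
    by eventually_elim (use pos in \<open>force simp: indicator_def\<close>)
  then have "D \<in> null_sets M"
    using AE_iff_null_sets[OF assms(2)] by blast
  with assms(3) show False by auto
qed

section \<open>Functionals attached to one cell\<close>

text \<open>This keeps just what the zero count uses: linearity on generalized polynomials and a
  mean value property. It covers point evaluations and integrals against positive measures
  alike.\<close>

definition cell_functional :: "(real \<Rightarrow> real) \<Rightarrow> nat \<Rightarrow> ((real \<Rightarrow> real) \<Rightarrow> real) \<Rightarrow> bool" where
  "cell_functional T j L \<longleftrightarrow>
     (\<forall>u k a. (\<forall>l\<le>k. continuous_on I (u l)) \<longrightarrow> L (gen_poly u k a) = (\<Sum>l\<le>k. a l * L (u l))) \<and>
     (\<forall>f. continuous_on I f \<longrightarrow> L f = 0 \<longrightarrow> (\<exists>z\<in>I. f z = 0 \<and> cell T z = j))"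

lemma cell_functional_eval:
  assumes "y \<in> extremal T j"
  shows "cell_functional T j (\<lambda>f. f y)"
  using assms by (auto simp: cell_functional_def gen_poly_def extremal_def)

text \<open>A vanishing integral over a set of positive measure forces values \<open>\<le> 0\<close>
  and \<open>\<ge> 0\<close> at points of the same cell, hence a zero in that cell.\<close>

lemma cell_functional_integral:
  assumes "finite_measure M" "sets M = sets borel_I" "continuous_on I T" "finite (zeros T)"
    and "emeasure M (extremal T j) \<noteq> 0"
  shows "cell_functional T j (\<lambda>f. \<integral>x. indicator (extremal T j) x * f x \<partial>M)"
  unfolding cell_functional_def
proof (intro conjI allI impI)
  have D: "extremal T j \<in> sets M"
    unfolding assms(2) by (rule extremal_sets[OF assms(3,4)])
  {
    fix u :: "nat \<Rightarrow> real \<Rightarrow> real" and k a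
    assume u: "\<forall>l\<le>k. continuous_on I (u l)"
    have int: "integrable M (\<lambda>x. indicator (extremal T j) x * u l x)" if "l \<le> k" for l
      using u that by (intro integrable_indicator_times integrable_continuous_I assms D) auto
    have "(\<integral>x. indicator (extremal T j) x * gen_poly u k a x \<partial>M) =
        (\<integral>x. (\<Sum>l\<le>k. a l * (indicator (extremal T j) x * u l x)) \<partial>M)"
      by (simp add: gen_poly_def sum_distrib_left mult.left_commute)
    also have "\<dots> = (\<Sum>l\<le>k. a l * (\<integral>x. indicator (extremal T j) x * u l x \<partial>M))"
      using int by (subst Bochner_Integration.integral_sum) auto
    finally show "(\<integral>x. indicator (extremal T j) x * gen_poly u k a x \<partial>M) =
        (\<Sum>l\<le>k. a l * (\<integral>x. indicator (extremal T j) x * u l x \<partial>M))" .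
  next
    fix f :: "real \<Rightarrow> real"
    assume f: "continuous_on I f" and zero: "(\<integral>x. indicator (extremal T j) x * f x \<partial>M) = 0"
    have int: "integrable M f" by (rule integrable_continuous_I[OF assms(1,2) f])
    obtain a where a: "a \<in> extremal T j" "f a \<le> 0"
      using integral_zero_imp_nonpos[OF int D assms(5) zero] by blast
    obtain b where b: "b \<in> extremal T j" "0 \<le> f b"
      using integral_zero_imp_nonpos[of M "\<lambda>x. - f x", OF _ D assms(5)] int zero by auto
    show "\<exists>z\<in>I. f z = 0 \<and> cell T z = j"
      using a b by (intro cell_zero[OF f _ _ a(2) b(2) assms(4)]) (auto simp: extremal_def)
  }
qed

text \<open>A nonzero \<open>d\<close> is a kernel vector of the square matrix
  \<open>L j (u l)\<close>. A kernel vector \<open>a\<close> of the transpose gives a nontrivial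
  polynomial annihilated by every \<open>L j\<close>, thus with \<open>k + 1\<close> zeros.\<close>

lemma cell_functionals_independent:
  assumes T: "T_system u k"
    and L: "\<And>j. j \<le> k \<Longrightarrow> cell_functional T j (L j)"
    and zero: "\<And>l. l \<le> k \<Longrightarrow> (\<Sum>j\<le>k. d j * L j (u l)) = 0"
    and "j \<le> k"
  shows "d j = 0"
proof (rule ccontr)
  assume "d j \<noteq> 0"
  then obtain a where a: "\<exists>l\<le>k. a l \<noteq> 0" "\<And>j. j \<le> k \<Longrightarrow> (\<Sum>l\<le>k. a l * L j (u l)) = 0"
    using square_kernel_transpose[of "Suc k" "\<lambda>l j. L j (u l)" d j] zero \<open>j \<le> k\<close>
    by (auto simp: lessThan_Suc_atMost less_Suc_eq_le mult.commute)
  have cont: "\<forall>l\<le>k. continuous_on I (u l)"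
    using T by (simp add: T_system_def)
  then have contp: "continuous_on I (gen_poly u k a)"
    unfolding gen_poly_def by (intro continuous_intros) auto
  have "\<exists>z\<in>I. gen_poly u k a z = 0 \<and> cell T z = j" if "j \<le> k" for j
    using L[OF that] a(2)[OF that] cont contp unfolding cell_functional_def by metis
  then obtain z where z: "\<And>j. j \<le> k \<Longrightarrow> z j \<in> I \<and> gen_poly u k a (z j) = 0 \<and> cell T (z j) = j"
    by metis
  \<comment> \<open>Zeros in different cells are different: \<open>cell T\<close> is a left inverse
    of \<open>z\<close>.\<close>
  have "inj_on z {..k}"
    by (intro inj_on_inverseI[of _ "cell T"]) (use z in simp)
  then have "card {..k} = card (z ` {..k})"
    by (rule card_image[symmetric])
  also have "\<dots> \<le> card {x\<in>I. gen_poly u k a x = 0}"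
    using T a(1) z by (intro card_mono) (auto simp only: T_system_def atMost_iff)
  also have "\<dots> \<le> k"
    using T a(1) unfolding T_system_def by blast
  finally have "card {..k} \<le> k" .
  then show False by simp
qed

text \<open>Almost every point lies in exactly one of the sets \<open>extremal T 0\<close> to
  \<open>extremal T k\<close>, since cell numbers do not exceed the number of zeros.\<close>

lemma integral_extremal:
  fixes f :: "real \<Rightarrow> real"
  assumes "sets M = sets borel_I" "continuous_on I T" "finite (zeros T)" "card (zeros T) \<le> k"
    and "integrable M f" and ae: "AE x in M. \<bar>T x\<bar> = 1"
  shows "(\<integral>x. f x \<partial>M) = (\<Sum>j\<le>k. \<integral>x. indicator (extremal T j) x * f x \<partial>M)"
proof -
  have int: "integrable M (\<lambda>x. indicator (extremal T j) x * f x)" for j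
    by (rule integrable_indicator_times[OF assms(5)])
      (unfold assms(1), rule extremal_sets[OF assms(2,3)])
  have sum: "f x = (\<Sum>j\<le>k. indicator (extremal T j) x * f x)" if "x \<in> I" "\<bar>T x\<bar> = 1" for x
  proof -
    have "cell T x \<le> k" using cell_le[OF assms(3)] assms(4) by (rule order_trans)
    moreover have "indicator (extremal T j) x = (if cell T x = j then 1 else 0::real)" for j
      using that by (simp add: extremal_def indicator_def)
    ultimately show ?thesis by (simp add: if_distrib[of "\<lambda>c. c * _"] cong: if_cong)
  qed
  have "AE x in M. f x = (\<Sum>j\<le>k. indicator (extremal T j) x * f x)"
    using ae AE_space by eventually_elim (rule sum, simp_all only: space_borel_I[OF assms(1)])
  then have "(\<integral>x. f x \<partial>M) = (\<integral>x. (\<Sum>j\<le>k. indicator (extremal T j) x * f x) \<partial>M)"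
    using assms(5) int
    by (intro integral_cong_AE borel_measurable_integrable Bochner_Integration.integrable_sum) auto
  also have "\<dots> = (\<Sum>j\<le>k. \<integral>x. indicator (extremal T j) x * f x \<partial>M)"
    using int by (rule Bochner_Integration.integral_sum)
  finally show ?thesis .
qed

text \<open>Both claims come from the nonnegative function \<open>1 - f\<close>: its integral is
  nonnegative, and if that integral is zero the function vanishes almost everywhere.\<close>

lemma AE_eq_if_integral_ge:
  fixes f :: "real \<Rightarrow> real"
  assumes "finite_measure M" "sets M = sets borel_I" "continuous_on I f" "\<And>x. x \<in> I \<Longrightarrow> f x \<le> 1"
  shows "(\<integral>x. f x \<partial>M) \<le> measure M I"
    and "measure M I \<le> (\<integral>x. f x \<partial>M) \<Longrightarrow> AE x in M. f x = 1"
proof -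
  interpret finite_measure M by fact
  have sp: "space M = I" by (rule space_borel_I[OF assms(2)])
  have int: "integrable M f" by (rule integrable_continuous_I[OF assms(1-3)])
  then have eq: "(\<integral>x. 1 - f x \<partial>M) = measure M I - (\<integral>x. f x \<partial>M)"
    by (subst Bochner_Integration.integral_diff) (simp_all add: sp)
  have nonneg: "AE x in M. 0 \<le> 1 - f x"
    using assms(4) by (intro AE_I2) (simp add: sp)
  then have "0 \<le> (\<integral>x. 1 - f x \<partial>M)" by (rule integral_nonneg_AE)
  with eq show "(\<integral>x. f x \<partial>M) \<le> measure M I" by linarith
  assume "measure M I \<le> (\<integral>x. f x \<partial>M)"
  with eq \<open>0 \<le> (\<integral>x. 1 - f x \<partial>M)\<close> have "(\<integral>x. 1 - f x \<partial>M) = 0" by linarith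
  then have "AE x in M. 1 - f x = 0"
    using integral_nonneg_eq_0_iff_AE[OF _ nonneg] int by auto
  then show "AE x in M. f x = 1" by eventually_elim simp
qed

lemma AE_support:
  assumes "sets M = sets borel_I" "msupport M \<subseteq> S"
  shows "AE x in M. x \<in> S"
proof -
  have "I - msupport M \<in> null_sets M"
    using emeasure_outside_support[OF assms(1)] assms(1) by (intro null_setsI) simp_all
  then have "AE x in M. x \<notin> I - msupport M" by (rule AE_not_in)
  then show ?thesis
    using AE_space by eventually_elim (use assms(2) space_borel_I[OF assms(1)] in blast)
qed

lemma emeasure_zero_if_AE_not:
  assumes "AE x in M. x \<notin> D" "D \<in> sets M"
  shows "emeasure M D = 0"
  using AE_iff_null_sets[OF assms(2)] assms(1) by blast

subsection \<open>Total variation and minimal extrapolation\<close>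

lemma abs_le_sup_norm:
  assumes "continuous_on I f" "x \<in> I"
  shows "\<bar>f x\<bar> \<le> sup_norm f"
proof -
  have "compact ((\<lambda>x. \<bar>f x\<bar>) ` I)"
    using assms(1) by (intro compact_continuous_image continuous_intros) auto
  then have "bdd_above ((\<lambda>x. \<bar>f x\<bar>) ` I)"
    by (intro bounded_imp_bdd_above compact_imp_bounded)
  then show ?thesis
    unfolding sup_norm_def using assms(2) by (rule cSUP_upper2) simp
qed

text \<open>The integral is that of \<open>T\<close> against the positive part plus that of
  \<open>- T\<close> against the negative part, each at most the respective mass. The sign condition
  allows the converse inequality to be read in the reals.\<close>

lemma signed_integral_le_tv_norm:
  assumes "signed_measure \<mu>" "continuous_on I T" "sup_norm T = 1"
  shows "ennreal (signed_integral \<mu> T) \<le> tv_norm \<mu>"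
    and "0 \<le> signed_integral \<mu> T \<Longrightarrow> tv_norm \<mu> \<le> ennreal (signed_integral \<mu> T) \<Longrightarrow>
      (AE x in pos_part \<mu>. T x = 1) \<and> (AE x in neg_part \<mu>. T x = - 1)"
proof -
  have J: "jordan_decomposition \<mu> (pos_part \<mu>) (neg_part \<mu>)"
    by (rule jordan_decomposition_parts[OF assms(1)])
  then have fin: "finite_measure (pos_part \<mu>)" "finite_measure (neg_part \<mu>)"
    and sets: "sets (pos_part \<mu>) = sets borel_I" "sets (neg_part \<mu>) = sets borel_I"
    by (auto simp: jordan_decomposition_def)
  have le: "T x \<le> 1" "- T x \<le> 1" if "x \<in> I" for x
    using abs_le_sup_norm[OF assms(2) that] assms(3) by auto
  have cont: "continuous_on I (\<lambda>x. - T x)"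
    using assms(2) by (rule continuous_on_minus)
  note pos = AE_eq_if_integral_ge[OF fin(1) sets(1) assms(2) le(1)]
  note neg = AE_eq_if_integral_ge[OF fin(2) sets(2) cont le(2)]
  have tv: "tv_norm \<mu> = ennreal (measure (pos_part \<mu>) I + measure (neg_part \<mu>) I)"
    by (rule tv_norm_jordan[OF J])
  have int: "signed_integral \<mu> T = (\<integral>x. T x \<partial>pos_part \<mu>) + (\<integral>x. - T x \<partial>neg_part \<mu>)"
    by (simp add: signed_integral_def)
  then show "ennreal (signed_integral \<mu> T) \<le> tv_norm \<mu>"
    unfolding tv using pos(1) neg(1) by (intro ennreal_leI) linarith
  assume "0 \<le> signed_integral \<mu> T" "tv_norm \<mu> \<le> ennreal (signed_integral \<mu> T)"
  then have "measure (pos_part \<mu>) I + measure (neg_part \<mu>) I \<le> signed_integral \<mu> T"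
    unfolding tv by (simp only: ennreal_le_iff)
  \<comment> \<open>When the sum of two upper bounds is reached, each bound is reached
    separately.\<close>
  then have "AE x in pos_part \<mu>. T x = 1" "AE x in neg_part \<mu>. - T x = 1"
    using pos(1) neg(1) int by (intro pos(2) neg(2); linarith)+
  then show "(AE x in pos_part \<mu>. T x = 1) \<and> (AE x in neg_part \<mu>. T x = - 1)"
    by (auto elim!: eventually_mono)
qed

lemma tv_norm_eq_signed_integral:
  assumes "signed_measure \<mu>" "AE x in pos_part \<mu>. T x = 1" "AE x in neg_part \<mu>. T x = - 1"
    and "continuous_on I T"
  shows "tv_norm \<mu> = ennreal (signed_integral \<mu> T)" "0 \<le> signed_integral \<mu> T"
proof -
  have J: "jordan_decomposition \<mu> (pos_part \<mu>) (neg_part \<mu>)"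
    by (rule jordan_decomposition_parts[OF assms(1)])
  then have sets: "sets (pos_part \<mu>) = sets borel_I" "sets (neg_part \<mu>) = sets borel_I"
    by (auto simp: jordan_decomposition_def)
  have "(\<integral>x. T x \<partial>pos_part \<mu>) = (\<integral>x. 1 \<partial>pos_part \<mu>)"
    using assms(2,4) sets(1) by (intro integral_cong_AE borel_measurable_continuous_I) auto
  moreover have "(\<integral>x. T x \<partial>neg_part \<mu>) = (\<integral>x. - 1 \<partial>neg_part \<mu>)"
    using assms(3,4) sets(2) by (intro integral_cong_AE borel_measurable_continuous_I) auto
  ultimately have "signed_integral \<mu> T = measure (pos_part \<mu>) I + measure (neg_part \<mu>) I"
    unfolding signed_integral_def
    by (simp add: space_borel_I[OF sets(1)] space_borel_I[OF sets(2)])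
  then show "tv_norm \<mu> = ennreal (signed_integral \<mu> T)" "0 \<le> signed_integral \<mu> T"
    unfolding tv_norm_jordan[OF J] by simp_all
qed

lemma signed_integral_gen_poly:
  assumes "signed_measure \<mu>" "\<And>l. l \<le> k \<Longrightarrow> continuous_on I (u l)"
  shows "signed_integral \<mu> (gen_poly u k a) = (\<Sum>l\<le>k. a l * signed_integral \<mu> (u l))"
proof -
  have J: "jordan_decomposition \<mu> (pos_part \<mu>) (neg_part \<mu>)"
    by (rule jordan_decomposition_parts[OF assms(1)])
  have "(\<integral>x. gen_poly u k a x \<partial>M) = (\<Sum>l\<le>k. a l * (\<integral>x. u l x \<partial>M))"
    if "finite_measure M" "sets M = sets borel_I" for M
    unfolding gen_poly_def using assms(2) integrable_continuous_I[OF that]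
    by (subst Bochner_Integration.integral_sum) auto
  with J show ?thesis
    by (simp add: signed_integral_def jordan_decomposition_def sum_subtractf right_diff_distrib)
qed

section \<open>Splitting signed measures over the cells\<close>

text \<open>Integrability is all that the splitting needs. The second claim is the case of an
  indicator, which is in general not continuous, and serves to recover the measure itself.\<close>

lemma signed_measure_extremal_sum:
  assumes "signed_measure \<mu>" "continuous_on I T" "finite (zeros T)" "card (zeros T) \<le> k"
    and ae: "AE x in pos_part \<mu>. T x = 1" "AE x in neg_part \<mu>. T x = - 1"
  shows "continuous_on I f \<Longrightarrow>
      signed_integral \<mu> f = (\<Sum>j\<le>k. signed_integral \<mu> (\<lambda>x. indicator (extremal T j) x * f x))"
    and "A \<in> sets borel_I \<Longrightarrow>
      \<mu> A = (\<Sum>j\<le>k. signed_integral \<mu> (\<lambda>x. indicator (extremal T j) x * indicator A x))"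
proof -
  have J: "jordan_decomposition \<mu> (pos_part \<mu>) (neg_part \<mu>)"
    by (rule jordan_decomposition_parts[OF assms(1)])
  then have fin: "finite_measure (pos_part \<mu>)" "finite_measure (neg_part \<mu>)"
    and sets: "sets (pos_part \<mu>) = sets borel_I" "sets (neg_part \<mu>) = sets borel_I"
    by (auto simp: jordan_decomposition_def)
  have abs: "AE x in pos_part \<mu>. \<bar>T x\<bar> = 1" "AE x in neg_part \<mu>. \<bar>T x\<bar> = 1"
    using ae by (auto elim!: eventually_mono)
  have sum: "signed_integral \<mu> f = (\<Sum>j\<le>k. signed_integral \<mu> (\<lambda>x. indicator (extremal T j) x * f x))"
    if "integrable (pos_part \<mu>) f" "integrable (neg_part \<mu>) f" for f
    unfolding signed_integral_def sum_subtractf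
      integral_extremal[OF sets(1) assms(2-4) that(1) abs(1)]
      integral_extremal[OF sets(2) assms(2-4) that(2) abs(2)] ..
  then show "signed_integral \<mu> f = (\<Sum>j\<le>k. signed_integral \<mu> (\<lambda>x. indicator (extremal T j) x * f x))"
    if "continuous_on I f"
    using integrable_continuous_I[OF fin(1) sets(1) that] integrable_continuous_I[OF fin(2) sets(2) that]
    by blast
  show "\<mu> A = (\<Sum>j\<le>k. signed_integral \<mu> (\<lambda>x. indicator (extremal T j) x * indicator A x))"
    if A: "A \<in> sets borel_I"
  proof -
    have ind: "integrable M (indicator A :: real \<Rightarrow> real)" "(\<integral>x. indicator A x \<partial>M) = measure M A"
      if "finite_measure M" "sets M = sets borel_I" for M
    proof -
      have "A \<in> sets M" using A that(2) by simp
      then show "integrable M (indicator A :: real \<Rightarrow> real)" "(\<integral>x. indicator A x \<partial>M) = measure M A"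
        using sets.sets_into_space[of A M] finite_measure.emeasure_finite[OF that(1), of A]
        by (auto simp: Int_absorb2 less_top)
    qed
    have "\<mu> A = signed_integral \<mu> (indicator A)"
      using J A by (simp add: signed_integral_def jordan_decomposition_def ind(2)[OF fin(1) sets(1)]
          ind(2)[OF fin(2) sets(2)])
    with sum[OF ind(1)[OF fin(1) sets(1)] ind(1)[OF fin(2) sets(2)]] show ?thesis by simp
  qed
qed

text \<open>Whatever the two measures do on a set \<open>extremal T j\<close>, their difference there is a multiple of a
  positive functional: either the set is a single point, or \<open>\<sigma>\<close> vanishes on it and \<open>\<mu>\<close> has constant
  sign.\<close>

lemma difference_on_extremal:
  assumes T: "continuous_on I T" "finite (zeros T)" "card (zeros T) \<le> k"
    and alt: "alternation T k x" and norm: "sup_norm T = 1" and k: "1 \<le> k" and j: "j \<le> k"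
    and sm: "signed_measure \<mu>" "signed_measure \<sigma>"
    and ae: "AE x in pos_part \<mu>. T x = 1" "AE x in neg_part \<mu>. T x = - 1"
    and supp: "AE x in pos_part \<sigma>. x \<in> alternation_points T k"
      "AE x in neg_part \<sigma>. x \<in> alternation_points T k"
  shows "\<exists>d L. cell_functional T j L \<and>
    (\<forall>f. signed_integral \<mu> (\<lambda>x. indicator (extremal T j) x * f x) -
         signed_integral \<sigma> (\<lambda>x. indicator (extremal T j) x * f x) = d * L f)"
proof -
  let ?D = "extremal T j"
  have fin: "finite_measure (pos_part \<nu>)" "finite_measure (neg_part \<nu>)"
    and sets: "sets (pos_part \<nu>) = sets borel_I" "sets (neg_part \<nu>) = sets borel_I"
    if "signed_measure \<nu>" for \<nu>
    using jordan_decomposition_parts[OF that] by (auto simp: jordan_decomposition_def)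
  have D: "?D \<in> sets borel_I" by (rule extremal_sets[OF T(1,2)])
  have xj: "x j \<in> ?D"
    using alternation_cell[OF T alt norm j] alternation_abs[OF alt norm k j] alt j
    by (auto simp: extremal_def alternation_def)
  show ?thesis
  proof (cases "?D = {x j}")
    \<comment> \<open>On a single point both measures are multiples of evaluation there.\<close>
    case True
    have sing: "{x j} \<in> sets borel_I" using D True by simp
    define d where "d = measure (pos_part \<mu>) {x j} - measure (neg_part \<mu>) {x j} -
      (measure (pos_part \<sigma>) {x j} - measure (neg_part \<sigma>) {x j})"
    have eval: "signed_integral \<nu> (\<lambda>y. indicator ?D y * f y) =
        f (x j) * (measure (pos_part \<nu>) {x j} - measure (neg_part \<nu>) {x j})"
      if "signed_measure \<nu>" for \<nu> f
      unfolding signed_integral_def True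
      using sing by (simp add: integral_indicator_singleton sets[OF that] right_diff_distrib)
    have "signed_integral \<mu> (\<lambda>y. indicator ?D y * f y) -
        signed_integral \<sigma> (\<lambda>y. indicator ?D y * f y) = d * f (x j)" for f
      unfolding eval[OF sm(1)] eval[OF sm(2)] d_def by (simp add: algebra_simps)
    then show ?thesis
      using cell_functional_eval[OF xj]
      by (intro exI[of _ d] exI[of _ "\<lambda>f. f (x j)"]) simp
  next
    case False
    \<comment> \<open>An alternation point would be the only element of its extremal set, so
      \<open>\<sigma>\<close> has no mass on \<open>?D\<close>.\<close>
    have "y \<notin> ?D" if "y \<in> alternation_points T k" for y
      using alternation_points_extremal[OF T alt norm k that] False by blast
    then have "AE y in pos_part \<sigma>. y \<notin> ?D" "AE y in neg_part \<sigma>. y \<notin> ?D"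
      using supp by (auto elim!: eventually_mono)
    then have "emeasure (pos_part \<sigma>) ?D = 0" "emeasure (neg_part \<sigma>) ?D = 0"
      using D by (auto intro!: emeasure_zero_if_AE_not simp: sets[OF sm(2)])
    then have \<sigma>0: "signed_integral \<sigma> (\<lambda>y. indicator ?D y * f y) = 0" for f
      unfolding signed_integral_def using D by (simp add: integral_indicator_null sets[OF sm(2)])
    \<comment> \<open>It remains to see \<open>\<mu>\<close> on \<open>?D\<close> as
      \<open>c\<close> times a positive measure \<open>M\<close>; the two uses below have
      \<open>c = 1\<close> and \<open>c = - 1\<close>.\<close>
    have goal: ?thesis
      if M: "finite_measure M" "sets M = sets borel_I"
        and eq: "\<And>f. signed_integral \<mu> (\<lambda>y. indicator ?D y * f y) =
          c * (\<integral>y. indicator ?D y * f y \<partial>M)" for M c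
    proof (cases "emeasure M ?D = 0")
      \<comment> \<open>Integration against a null measure has no mean value property, so evaluation
        at \<open>x j\<close> with factor 0 takes its place.\<close>
      case True
      then have "(\<integral>y. indicator ?D y * f y \<partial>M) = 0" for f :: "real \<Rightarrow> real"
        using D by (intro integral_indicator_null) (simp_all add: M(2))
      then show ?thesis
        using cell_functional_eval[OF xj] eq \<sigma>0
        by (intro exI[of _ 0] exI[of _ "\<lambda>f. f (x j)"]) simp
    next
      case False
      then show ?thesis
        using cell_functional_integral[OF M T(1,2) False] eq \<sigma>0
        by (intro exI[of _ c] exI[of _ "\<lambda>f. \<integral>y. indicator ?D y * f y \<partial>M"]) simp
    qed
    \<comment> \<open>\<open>T\<close> is constant on \<open>?D\<close>, so one of the two parts of
      \<open>\<mu>\<close> is null there.\<close>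
    have sign: "T y = T (x j)" if "y \<in> ?D" for y
      using same_cell_same_sign[OF T(1,2), of y "x j"] that xj
      by (auto simp: extremal_def abs_if split: if_splits)
    have "T (x j) = 1 \<or> T (x j) = - 1"
      using xj by (auto simp: extremal_def abs_if split: if_splits)
    then show ?thesis
    proof
      assume 1: "T (x j) = 1"
      have "AE y in neg_part \<mu>. y \<notin> ?D"
        using ae(2) by eventually_elim (use sign 1 in auto)
      then have "emeasure (neg_part \<mu>) ?D = 0"
        using D by (intro emeasure_zero_if_AE_not) (simp_all add: sets[OF sm(1)])
      then have "signed_integral \<mu> (\<lambda>y. indicator ?D y * f y) =
          1 * (\<integral>y. indicator ?D y * f y \<partial>pos_part \<mu>)" for f
        unfolding signed_integral_def using D
        by (simp add: integral_indicator_null sets[OF sm(1)])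
      then show ?thesis by (rule goal[OF fin(1)[OF sm(1)] sets(1)[OF sm(1)]])
    next
      assume 1: "T (x j) = - 1"
      have "AE y in pos_part \<mu>. y \<notin> ?D"
        using ae(1) by eventually_elim (use sign 1 in auto)
      then have "emeasure (pos_part \<mu>) ?D = 0"
        using D by (intro emeasure_zero_if_AE_not) (simp_all add: sets[OF sm(1)])
      then have "signed_integral \<mu> (\<lambda>y. indicator ?D y * f y) =
          - 1 * (\<integral>y. indicator ?D y * f y \<partial>neg_part \<mu>)" for f
        unfolding signed_integral_def using D
        by (simp add: integral_indicator_null sets[OF sm(1)])
      then show ?thesis by (rule goal[OF fin(2)[OF sm(1)] sets(2)[OF sm(1)]])
    qed
  qed
qed

section \<open>Optimality and uniqueness\<close>

text \<open>Positivity of \<open>T 1\<close> rules out vanishing coefficients, so the zero bound of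
  the T-system applies to \<open>T\<close>.\<close>

lemma gen_chebyshev_zeros:
  assumes "T_system u k" "gen_chebyshev u k T"
  shows "continuous_on I T" "finite (zeros T)" "card (zeros T) \<le> k"
proof -
  obtain a where a: "T = gen_poly u k a"
    using assms(2) by (auto simp: gen_chebyshev_def)
  show "continuous_on I T"
    unfolding a gen_poly_def using assms(1)
    by (intro continuous_intros) (auto simp: T_system_def)
  have "\<exists>l\<le>k. a l \<noteq> 0"
  proof (rule ccontr)
    assume "\<not> ?thesis"
    then have "T 1 = 0" by (simp add: a gen_poly_def)
    then show False using assms(2) by (simp add: gen_chebyshev_def)
  qed
  then show "finite (zeros T)" "card (zeros T) \<le> k"
    using assms(1) unfolding zeros_def a T_system_def by blast+
qed

theorem proposition3p3:
  fixes u :: "nat \<Rightarrow> real \<Rightarrow> real" and n k :: nat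
    and T :: "real \<Rightarrow> real" and \<sigma> :: "real set \<Rightarrow> real"
  assumes "M_system u n"
    and "1 \<le> k" and "k \<le> n"
    and "gen_chebyshev u k T"
    and "signed_measure \<sigma>"
    and "msupport (pos_part \<sigma>) \<subseteq> E_plus T k"
    and "msupport (neg_part \<sigma>) \<subseteq> E_minus T k"
  shows "minimal_extrapolation u n (gen_moments u n \<sigma>) \<sigma> \<and>
    (\<forall>\<mu>. minimal_extrapolation u n (gen_moments u n \<sigma>) \<mu> \<longrightarrow> signed_eq \<mu> \<sigma>)"
proof -
  have Tsys: "T_system u k"
    using assms(1,3) by (simp add: M_system_def)
  then have cont: "continuous_on I (u l)" if "l \<le> k" for l
    using that by (simp add: T_system_def)
  note T = gen_chebyshev_zeros[OF Tsys assms(4)]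
  obtain a x where a: "T = gen_poly u k a" and alt: "alternation T k x" and norm: "sup_norm T = 1"
    using assms(4) by (auto simp: gen_chebyshev_def)
  have sets: "sets (pos_part \<sigma>) = sets borel_I" "sets (neg_part \<sigma>) = sets borel_I"
    using jordan_decomposition_parts[OF assms(5)] by (auto simp: jordan_decomposition_def)
  note supp = AE_support[OF sets(1) assms(6)] AE_support[OF sets(2) assms(7)]
  have ae\<sigma>: "AE x in pos_part \<sigma>. T x = 1" "AE x in neg_part \<sigma>. T x = - 1"
    and ap: "AE x in pos_part \<sigma>. x \<in> alternation_points T k"
      "AE x in neg_part \<sigma>. x \<in> alternation_points T k"
    using supp by (auto simp: E_plus_def E_minus_def norm elim!: eventually_mono)
  have tv\<sigma>: "tv_norm \<sigma> = ennreal (signed_integral \<sigma> T)" "0 \<le> signed_integral \<sigma> T"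
    by (rule tv_norm_eq_signed_integral[OF assms(5) ae\<sigma> T(1)])+
  have moments: "signed_integral \<mu> (u l) = signed_integral \<sigma> (u l)"
    if "gen_moments u n \<mu> = gen_moments u n \<sigma>" "l \<le> k" for \<mu> l
    using that assms(3) by (auto simp: gen_moments_def map_eq_conv simp del: upt_Suc)
  \<comment> \<open>\<open>T\<close> acts as a dual certificate: it lies in the span of
    \<open>u 0\<close> to \<open>u k\<close> with \<open>k \<le> n\<close>, so the moments determine
    its integral.\<close>
  have same: "signed_integral \<mu> T = signed_integral \<sigma> T"
    if "signed_measure \<mu>" "gen_moments u n \<mu> = gen_moments u n \<sigma>" for \<mu>
    unfolding a using moments[OF that(2)]
    by (simp add: signed_integral_gen_poly[OF that(1) cont] signed_integral_gen_poly[OF assms(5) cont])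
  have min: "minimal_extrapolation u n (gen_moments u n \<sigma>) \<sigma>"
    unfolding minimal_extrapolation_def tv\<sigma>(1)
    using assms(5) same signed_integral_le_tv_norm(1)[OF _ T(1) norm] by metis
  have "\<mu> A = \<sigma> A" if ext: "minimal_extrapolation u n (gen_moments u n \<sigma>) \<mu>"
    and A: "A \<in> sets borel_I" for \<mu> A
  proof -
    have sm: "signed_measure \<mu>" and mom: "gen_moments u n \<mu> = gen_moments u n \<sigma>"
      and "tv_norm \<mu> \<le> tv_norm \<sigma>"
      using ext assms(5) by (auto simp: minimal_extrapolation_def)
    then have ae: "AE x in pos_part \<mu>. T x = 1" "AE x in neg_part \<mu>. T x = - 1"
      using signed_integral_le_tv_norm(2)[OF sm T(1) norm] by (simp_all add: tv\<sigma> same[OF sm mom])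
    \<comment> \<open>The contribution of cell \<open>j\<close> to the integral of \<open>f\<close>
      against \<open>\<mu> - \<sigma>\<close>.\<close>
    define G where "G j f = signed_integral \<mu> (\<lambda>x. indicator (extremal T j) x * f x) -
      signed_integral \<sigma> (\<lambda>x. indicator (extremal T j) x * f x)" for j f
    have "\<exists>d L. cell_functional T j L \<and> (\<forall>f. G j f = d * L f)" if "j \<le> k" for j
      unfolding G_def
      by (rule difference_on_extremal[OF T alt norm assms(2) that sm assms(5) ae ap])
    then obtain d L where L: "\<And>j. j \<le> k \<Longrightarrow> cell_functional T j (L j)"
      and G: "\<And>j f. j \<le> k \<Longrightarrow> G j f = d j * L j f"
      by metis
    have "(\<Sum>j\<le>k. d j * L j (u l)) = 0" if "l \<le> k" for l
    proof -
      have "(\<Sum>j\<le>k. d j * L j (u l)) = (\<Sum>j\<le>k. G j (u l))"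
        using G by simp
      also have "\<dots> = signed_integral \<mu> (u l) - signed_integral \<sigma> (u l)"
        unfolding G_def sum_subtractf
          signed_measure_extremal_sum(1)[OF sm T ae cont[OF that]]
          signed_measure_extremal_sum(1)[OF assms(5) T ae\<sigma> cont[OF that]] ..
      finally show ?thesis using moments[OF mom that] by simp
    qed
    then have d: "d j = 0" if "j \<le> k" for j
      using cell_functionals_independent[OF Tsys L _ that] by blast
    \<comment> \<open>The factorization \<open>G j f = d j * L j f\<close> holds for all
      \<open>f\<close>, so vanishing \<open>d j\<close> also settles the discontinuous
      indicators.\<close>
    have "\<mu> A - \<sigma> A = (\<Sum>j\<le>k. G j (indicator A))"
      unfolding G_def sum_subtractf
        signed_measure_extremal_sum(2)[OF sm T ae A]
        signed_measure_extremal_sum(2)[OF assms(5) T ae\<sigma> A] ..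
    also have "\<dots> = 0"
      using G d by simp
    finally show ?thesis by simp
  qed
  with min show ?thesis
    by (simp add: signed_eq_def)
qed

end
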